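(* Let $F:[0,\infty)\times\mathbb{R}^d\to\mathbb{R}^d$ be continuous in $t$, locally Lipschitz in $y$, with $F(t,0)\equiv 0$, let $\alpha:[0,\infty)\to[0,\infty)$ be continuous and strictly increasing with $\alpha(0)=0$, and let $E(t)=E_\alpha(t)$ be associated with the zero solution of $\dot y(t)=F(t,y)$, $y(0)=0$. (1) Given $T>0$ and $\epsilon>0$, there exists $h_0>0$ such that $0<h<h_0$ implies $$\sup_{\tilde y\in\tilde Y_\alpha(h)}\|\tilde y(t;h)\| = e_\alpha(t;h)\le (E(t)+\epsilon)\,\alpha(h)\qquad\text{for all } 0\le t\le T.$$ (2) Further, for $t\ge 0$, if $\theta<E(t)$ then there exists $\epsilon>0$ such that $e_\alpha(t;h)>(\theta+\epsilon)\alpha(h)$ for arbitrarily small $h>0$.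
   Context: Norms are Euclidean. "Locally Lipschitz in $y$" means that each point $(t,y)$ has a neighbourhood on which $F$ is Lipschitz in $y$ with a constant independent of $t$. Let $y(t;s,\eta)$ denote the solution of $\dot y=F(t,y)$ with $y(s)=\eta$. For $h>0$ the family $\tilde Y_\alpha(h)$ of approximations to the zero solution consists of all functions $\tilde y(\cdot;h)$ obtained from sequences $v_1,v_2,\dots\in\mathbb{R}^d$ with $\|v_n\|\le 1$ by $\tilde y(0;h)=0$, $\tilde y(nh;h)=y(nh;(n-1)h,\tilde y((n-1)h;h))+h\alpha(h)v_n$ for $n\ge1$, and $\tilde y(t;h)=y(t;(n-1)h,\tilde y((n-1)h;h))$ for $(n-1)h\le t<nh$. For every $T>0$ all these approximations exist on $[0,T]$ once $h$ is small enough. Define $e_\alpha(t;h)=\sup_{\tilde y\in\tilde Y_\alpha(h)}\|\tilde y(t;h)\|$ and $E_\alpha(t)=\limsup_{h\to0^+} e_\alpha(t;h)/\alpha(h)$. *)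

theory Defs
  imports "HOL-Analysis.Analysis"
begin

definition solves_ivp ::
  "(real \<Rightarrow> real ^ 'd \<Rightarrow> real ^ 'd) \<Rightarrow> real \<Rightarrow> real ^ 'd \<Rightarrow> real \<Rightarrow> (real \<Rightarrow> real ^ 'd) \<Rightarrow> bool"
  where "solves_ivp F s \<eta> t y \<longleftrightarrow>
    y s = \<eta> \<and> (\<forall>\<tau>\<in>{s..t}. (y has_vector_derivative F \<tau> (y \<tau>)) (at \<tau> within {s..t}))"

text \<open>The value \<open>y(t; s, \<eta>)\<close> for \<open>s \<le> t\<close>. For the fields \<open>F\<close> considered it is unique whenever the
  solution exists on \<open>[s, t]\<close>; otherwise it is an unspecified vector. Since on each \<open>[0, T]\<close> all
  approximations exist for small \<open>h\<close>, such values do not affect limits as \<open>h\<close> tends to \<open>0\<close>.\<close>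

definition sol ::
  "(real \<Rightarrow> real ^ 'd \<Rightarrow> real ^ 'd) \<Rightarrow> real \<Rightarrow> real \<Rightarrow> real ^ 'd \<Rightarrow> real ^ 'd"
  where "sol F t s \<eta> = (THE x. \<exists>y. solves_ivp F s \<eta> t y \<and> y t = x)"

text \<open>Only the values at times \<open>t \<ge> 0\<close> of a member are meaningful.\<close>

definition approximations ::
  "(real \<Rightarrow> real ^ 'd \<Rightarrow> real ^ 'd) \<Rightarrow> (real \<Rightarrow> real) \<Rightarrow> real \<Rightarrow> (real \<Rightarrow> real ^ 'd) set"
  where "approximations F \<alpha> h = {y. \<exists>v :: nat \<Rightarrow> real ^ 'd.
    (\<forall>n\<ge>1. norm (v n) \<le> 1) \<and>
    y 0 = 0 \<and>
    (\<forall>n\<ge>1. y (real n * h) =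
      sol F (real n * h) ((real n - 1) * h) (y ((real n - 1) * h)) + (h * \<alpha> h) *\<^sub>R v n) \<and>
    (\<forall>n\<ge>1. \<forall>t. (real n - 1) * h \<le> t \<and> t < real n * h \<longrightarrow>
      y t = sol F t ((real n - 1) * h) (y ((real n - 1) * h)))}"

definition err ::
  "(real \<Rightarrow> real ^ 'd \<Rightarrow> real ^ 'd) \<Rightarrow> (real \<Rightarrow> real) \<Rightarrow> real \<Rightarrow> real \<Rightarrow> ereal"
  where "err F \<alpha> t h = (SUP y\<in>approximations F \<alpha> h. ereal (norm (y t)))"

definition err_limsup ::
  "(real \<Rightarrow> real ^ 'd \<Rightarrow> real ^ 'd) \<Rightarrow> (real \<Rightarrow> real) \<Rightarrow> real \<Rightarrow> ereal"
  where "err_limsup F \<alpha> t = Limsup (at_right 0) (\<lambda>h. err F \<alpha> t h / ereal (\<alpha> h))"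

end

theory Submission
  imports Defs
begin

text \<open>
  Near the zero solution \<open>\<parallel>F(t, y)\<parallel> \<le> L\<parallel>y\<parallel>\<close>, so one step of the flow of length at most \<open>h\<close> moves
  \<open>\<eta>\<close> by at most \<open>2Lh\<parallel>\<eta>\<parallel>\<close>. A discrete Gronwall argument then bounds every approximation on \<open>[0, T]\<close>
  by a constant times \<open>\<alpha>(h)\<close>, and since the jumps have size at most \<open>h\<alpha>(h)\<close>, it varies between two times \<open>a\<close>, \<open>b\<close> by at
  most \<open>D(\<bar>b - a\<bar> + 3h)\<alpha>(h)\<close>. Hence the functions \<open>e\<^sub>\<alpha>(\<cdot>; h)/\<alpha>(h)\<close> are equicontinuous up to an error
  vanishing with \<open>h\<close>, and for such a family the upper limit is approached from above uniformly on compact sets.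
\<close>

section \<open>Uniqueness for the initial value problem\<close>

text \<open>Gronwall in differential form. Both trajectories on \<open>{s..t}\<close> lie in one
  compact set, where the local condition yields a single Lipschitz constant \<open>L\<close> for all
  times. By Cauchy-Schwarz, the squared distance of the solutions weighted by
  \<open>exp (- 2 * L * \<tau>)\<close> has nonpositive derivative; it vanishes at \<open>s\<close>,
  so it vanishes at \<open>t\<close>.\<close>

lemma solves_ivp_unique:
  assumes cont: "\<And>x. continuous_on {s..t} (\<lambda>\<tau>. F \<tau> x)"
    and lip: "local_lipschitz {s..t} UNIV F"
    and "s \<le> t" and y: "solves_ivp F s \<eta> t y" and z: "solves_ivp F s \<eta> t z"
  shows "y t = z t"
proof (cases "s = t")
  case True
  with y z show ?thesis by (simp add: solves_ivp_def)
next
  case False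
  with \<open>s \<le> t\<close> have "s < t" by simp
  define X where "X = y ` {s..t} \<union> z ` {s..t}"
  have dy: "(y has_vector_derivative F \<tau> (y \<tau>)) (at \<tau> within {s..t})"
    and dz: "(z has_vector_derivative F \<tau> (z \<tau>)) (at \<tau> within {s..t})" if "\<tau> \<in> {s..t}" for \<tau>
    using y z that by (auto simp: solves_ivp_def)
  have X: "compact X"
    unfolding X_def
    by (intro compact_Un compact_continuous_image)
      (auto intro!: has_vector_derivative_continuous dy dz simp: continuous_on_eq_continuous_within)
  have "local_lipschitz {s..t} X F"
    by (rule local_lipschitz_subset[OF lip order_refl subset_UNIV])
  then obtain L where L: "\<And>\<tau>. \<tau> \<in> {s..t} \<Longrightarrow> L-lipschitz_on X (F \<tau>)"
    by (rule local_lipschitz_compact_implies_lipschitz[where f = F, OF _ X compact_Icc cont]) blast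
  define g where "g \<tau> = exp (- 2 * L * \<tau>) * ((y \<tau> - z \<tau>) \<bullet> (y \<tau> - z \<tau>))" for \<tau>
  define g' where "g' \<tau> = exp (- 2 * L * \<tau>) *
      (2 * ((y \<tau> - z \<tau>) \<bullet> (F \<tau> (y \<tau>) - F \<tau> (z \<tau>))) - 2 * L * ((y \<tau> - z \<tau>) \<bullet> (y \<tau> - z \<tau>)))" for \<tau>
  have "(g has_derivative (\<lambda>u. u * g' \<tau>)) (at \<tau> within {s..t})" if "s \<le> \<tau>" "\<tau> \<le> t" for \<tau>
  proof -
    have d: "((\<lambda>\<tau>. y \<tau> - z \<tau>) has_derivative (\<lambda>u. u *\<^sub>R (F \<tau> (y \<tau>) - F \<tau> (z \<tau>)))) (at \<tau> within {s..t})"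
      using has_vector_derivative_diff[OF dy dz] that by (simp add: has_vector_derivative_def)
    have e: "((\<lambda>\<tau>. exp (- 2 * L * \<tau>)) has_derivative (\<lambda>u. u * (- 2 * L * exp (- 2 * L * \<tau>)))) (at \<tau> within {s..t})"
      by (auto intro!: derivative_eq_intros)
    show ?thesis
      unfolding g_def
      by (rule has_derivative_eq_rhs[OF has_derivative_mult[OF e has_derivative_inner[OF d d]]])
        (simp add: g'_def fun_eq_iff inner_commute algebra_simps)
  qed
  then obtain \<tau> where \<tau>: "\<tau> \<in> {s<..<t}" and eq: "g t - g s = (t - s) * g' \<tau>"
    using mvt_simple[where f = g and f' = "\<lambda>\<tau> u. u * g' \<tau>", OF \<open>s < t\<close>] by blast
  have "(y \<tau> - z \<tau>) \<bullet> (F \<tau> (y \<tau>) - F \<tau> (z \<tau>)) \<le> norm (y \<tau> - z \<tau>) * norm (F \<tau> (y \<tau>) - F \<tau> (z \<tau>))"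
    by (rule norm_cauchy_schwarz)
  also have "\<dots> \<le> norm (y \<tau> - z \<tau>) * (L * norm (y \<tau> - z \<tau>))"
    using lipschitz_onD[OF L[of \<tau>], of "y \<tau>" "z \<tau>"] \<tau>
    by (intro mult_left_mono) (auto simp: X_def dist_norm)
  also have "\<dots> = L * ((y \<tau> - z \<tau>) \<bullet> (y \<tau> - z \<tau>))"
    by (simp add: dot_square_norm power2_eq_square)
  finally have "g' \<tau> \<le> 0"
    unfolding g'_def by (intro mult_nonneg_nonpos) auto
  with eq \<open>s < t\<close> have "g t \<le> g s"
    by (smt (verit) mult_nonneg_nonpos)
  also have "g s = 0"
    using y z by (simp add: g_def solves_ivp_def)
  finally have "(y t - z t) \<bullet> (y t - z t) \<le> 0"
    by (simp add: g_def mult_le_0_iff del: inner_eq_zero_iff)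
  then show ?thesis
    by (metis eq_iff_diff_eq_0 inner_eq_zero_iff inner_ge_zero order_antisym)
qed

lemma sol_eqI:
  assumes "\<And>x. continuous_on {s..t} (\<lambda>\<tau>. F \<tau> x)" and "local_lipschitz {s..t} UNIV F"
    and "s \<le> t" and "solves_ivp F s \<eta> t y"
  shows "sol F t s \<eta> = y t"
  unfolding sol_def using assms solves_ivp_unique by (intro the_equality) blast+

section \<open>Existence on short intervals and the displacement of the flow\<close>

text \<open>Picard iteration by Banach's fixed point theorem. The condition
  \<open>L * (t - s) \<le> 1 / 2\<close> serves three times: it keeps the iterates in the ball
  (\<open>r / 2\<close> from \<open>\<eta>\<close>, \<open>r / 2\<close> from the integral), it
  gives the contraction factor, and it yields the a priori bound on the solution. The displacement
  bound is proportional to \<open>norm \<eta>\<close> instead of \<open>r\<close>, as the later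
  discrete Gronwall argument requires.\<close>

lemma solves_ivp_exists:
  fixes F :: "real \<Rightarrow> real ^ 'd \<Rightarrow> real ^ 'd"
  assumes cont: "continuous_on ({s..t} \<times> cball 0 r) (\<lambda>(\<tau>, x). F \<tau> x)"
    and lip: "\<And>\<tau>. \<tau> \<in> {s..t} \<Longrightarrow> L-lipschitz_on (cball 0 r) (F \<tau>)"
    and zero: "\<And>\<tau>. \<tau> \<in> {s..t} \<Longrightarrow> F \<tau> 0 = 0"
    and "s \<le> t" and small: "L * (t - s) \<le> 1 / 2" and \<eta>: "norm \<eta> \<le> r / 2"
  obtains y where "solves_ivp F s \<eta> t y" "norm (y t - \<eta>) \<le> 2 * L * (t - s) * norm \<eta>"
proof -
  have "L \<ge> 0"
    using lipschitz_on_nonneg[OF lip] \<open>s \<le> t\<close> by fastforce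
  have "r \<ge> 0"
    using \<eta> norm_ge_zero[of \<eta>] by linarith
  \<comment> \<open>Bounded continuous functions on the whole line form a complete metric space;
    \<open>clip\<close> freezes time outside \<open>{s..t}\<close>, so that the Picard map
    \<open>P\<close> acts on this space and problems at the ends of the interval do not
    arise.\<close>
  define B where "B = (PiC UNIV (\<lambda>_. cball 0 r) :: (real \<Rightarrow>\<^sub>C (real ^ 'd)) set)"
  define I where "I y \<tau> = integral {s..\<tau>} (\<lambda>\<sigma>. F \<sigma> (y \<sigma>))" for y :: "real \<Rightarrow> real ^ 'd" and \<tau>
  define clip where "clip \<tau> = max s (min t \<tau>)" for \<tau>
  define P where "P y = Bcontfun (\<lambda>\<tau>. \<eta> + I (apply_bcontfun y) (clip \<tau>))" for y
  have clip: "clip \<tau> \<in> {s..t}" for \<tau>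
    using \<open>s \<le> t\<close> by (auto simp: clip_def)
  have contF: "continuous_on {s..t} (\<lambda>\<sigma>. F \<sigma> (y \<sigma>))"
    if "continuous_on {s..t} y" "\<And>\<sigma>. \<sigma> \<in> {s..t} \<Longrightarrow> norm (y \<sigma>) \<le> r" for y
  proof -
    have "continuous_on {s..t} (\<lambda>\<sigma>. (\<sigma>, y \<sigma>))"
      by (intro continuous_intros that)
    then show ?thesis
      using continuous_on_compose2[OF cont, of "{s..t}" "\<lambda>\<sigma>. (\<sigma>, y \<sigma>)"] that(2)
      by (simp add: image_subset_iff)
  qed
  \<comment> \<open>The Lipschitz estimate is applied against the zero solution, where
    \<open>F\<close> vanishes.\<close>
  have boundF: "norm (F \<sigma> x) \<le> L * norm x" if "\<sigma> \<in> {s..t}" "norm x \<le> r" for \<sigma> x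
    using lipschitz_onD[OF lip[OF that(1)], of x 0] zero that \<open>r \<ge> 0\<close> by (simp add: dist_norm)
  have boundI: "norm (I y \<tau>) \<le> L * (t - s) * M"
    if "continuous_on {s..t} y" "\<And>\<sigma>. \<sigma> \<in> {s..t} \<Longrightarrow> norm (y \<sigma>) \<le> M" "M \<le> r" "\<tau> \<in> {s..t}"
    for y \<tau> M
  proof -
    have le: "norm (y \<sigma>) \<le> r" if "\<sigma> \<in> {s..t}" for \<sigma>
      using that \<open>M \<le> r\<close> \<open>\<And>\<sigma>. \<sigma> \<in> {s..t} \<Longrightarrow> norm (y \<sigma>) \<le> M\<close> by (meson order_trans)
    have "M \<ge> 0"
      using that(2)[OF \<open>\<tau> \<in> {s..t}\<close>] norm_ge_zero[of "y \<tau>"] by linarith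
    have "norm (I y \<tau>) \<le> L * M * (\<tau> - s)"
      unfolding I_def
    proof (rule integral_bound)
      show "continuous_on {s..\<tau>} (\<lambda>\<sigma>. F \<sigma> (y \<sigma>))"
        using that le by (intro continuous_on_subset[OF contF]) auto
      show "norm (F \<sigma> (y \<sigma>)) \<le> L * M" if "\<sigma> \<in> {s..\<tau>}" for \<sigma>
        using boundF[of \<sigma> "y \<sigma>"] le[of \<sigma>] that \<open>\<tau> \<in> {s..t}\<close> \<open>L \<ge> 0\<close>
          mult_left_mono[OF \<open>\<And>\<sigma>. \<sigma> \<in> {s..t} \<Longrightarrow> norm (y \<sigma>) \<le> M\<close>[of \<sigma>], of L] by simp
    qed (use \<open>\<tau> \<in> {s..t}\<close> in auto)
    also have "\<dots> \<le> L * M * (t - s)"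
      using \<open>L \<ge> 0\<close> \<open>M \<ge> 0\<close> \<open>\<tau> \<in> {s..t}\<close> by (intro mult_left_mono) auto
    finally show ?thesis by (simp add: mult_ac)
  qed
  \<comment> \<open>\<open>Bcontfun\<close> inverts \<open>apply_bcontfun\<close> only on bounded
    continuous functions, so the integral formula for \<open>P y\<close> is available once the
    integral has been shown to be continuous and to stay in the ball.\<close>
  have P_apply: "apply_bcontfun (P y) \<tau> = \<eta> + I (apply_bcontfun y) (clip \<tau>)"
    and P_bound: "norm (apply_bcontfun (P y) \<tau>) \<le> r" if "y \<in> B" for y \<tau>
  proof -
    have le: "norm (apply_bcontfun y \<sigma>) \<le> r" for \<sigma>
      using that by (auto simp: B_def mem_PiC_iff Pi_def)
    have bd: "norm (\<eta> + I (apply_bcontfun y) (clip \<tau>)) \<le> r" for \<tau>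
    proof -
      have "norm (I (apply_bcontfun y) (clip \<tau>)) \<le> L * (t - s) * r"
        by (rule boundI) (use le clip in auto)
      also have "\<dots> \<le> 1 / 2 * r"
        using small \<open>r \<ge> 0\<close> by (rule mult_right_mono)
      finally show ?thesis
        using \<eta> norm_triangle_ineq[of \<eta> "I (apply_bcontfun y) (clip \<tau>)"] by linarith
    qed
    have "continuous_on {s..t} (I (apply_bcontfun y))"
      unfolding I_def
      by (intro indefinite_integral_continuous_1 integrable_continuous_real contF) (use le in auto)
    moreover have "continuous_on UNIV clip"
      unfolding clip_def by (intro continuous_intros)
    ultimately have "continuous_on UNIV (\<lambda>\<tau>. I (apply_bcontfun y) (clip \<tau>))"
      by (rule continuous_on_compose2) (simp add: image_subset_iff clip del: atLeastAtMost_iff)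
    then have "continuous_on UNIV (\<lambda>\<tau>. \<eta> + I (apply_bcontfun y) (clip \<tau>))"
      by (intro continuous_on_add continuous_on_const)
    then show eq: "apply_bcontfun (P y) \<tau> = \<eta> + I (apply_bcontfun y) (clip \<tau>)" for \<tau>
      unfolding P_def using bd by (subst Bcontfun_inverse) (auto intro: bcontfun_normI)
    show "norm (apply_bcontfun (P y) \<tau>) \<le> r"
      using bd eq by simp
  qed
  have "\<exists>!y\<in>B. P y = y"
  proof (rule Banach_fix)
    show "complete B"
      unfolding B_def complete_eq_closed by (rule closed_PiC) auto
    have "const_bcontfun 0 \<in> B"
      using \<open>r \<ge> 0\<close> by (auto simp: B_def mem_PiC_iff const_bcontfun.rep_eq)
    then show "B \<noteq> {}" by blast
    show "P ` B \<subseteq> B"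
      using P_bound by (simp add: image_subset_iff) (simp add: B_def mem_PiC_iff)
    show "(0::real) \<le> 1 / 2" "1 / 2 < (1::real)" by auto
    fix y z assume yz: "y \<in> B" "z \<in> B"
    have le: "norm (apply_bcontfun y \<sigma>) \<le> r" "norm (apply_bcontfun z \<sigma>) \<le> r" for \<sigma>
      using yz by (auto simp: B_def mem_PiC_iff Pi_def)
    show "dist (P y) (P z) \<le> 1 / 2 * dist y z"
    proof (rule dist_bound)
      fix \<tau>
      let ?u = "clip \<tau>"
      have cy: "continuous_on {s..?u} (\<lambda>\<sigma>. F \<sigma> (apply_bcontfun y \<sigma>))"
        and cz: "continuous_on {s..?u} (\<lambda>\<sigma>. F \<sigma> (apply_bcontfun z \<sigma>))"
        using clip[of \<tau>] le by (auto intro!: continuous_on_subset[OF contF])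
      have "dist (apply_bcontfun (P y) \<tau>) (apply_bcontfun (P z) \<tau>) =
          norm (integral {s..?u} (\<lambda>\<sigma>. F \<sigma> (apply_bcontfun y \<sigma>) - F \<sigma> (apply_bcontfun z \<sigma>)))"
        using cy cz yz
        by (simp add: P_apply I_def dist_norm integral_diff integrable_continuous_real)
      also have "\<dots> \<le> L * dist y z * (?u - s)"
      proof (rule integral_bound)
        show "continuous_on {s..?u} (\<lambda>\<sigma>. F \<sigma> (apply_bcontfun y \<sigma>) - F \<sigma> (apply_bcontfun z \<sigma>))"
          by (intro continuous_on_diff cy cz)
        fix \<sigma> assume \<sigma>: "\<sigma> \<in> {s..?u}"
        have "norm (F \<sigma> (apply_bcontfun y \<sigma>) - F \<sigma> (apply_bcontfun z \<sigma>))
            \<le> L * dist (apply_bcontfun y \<sigma>) (apply_bcontfun z \<sigma>)"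
          using lipschitz_onD[OF lip, of \<sigma> "apply_bcontfun y \<sigma>" "apply_bcontfun z \<sigma>"] le \<sigma> clip[of \<tau>]
          by (simp add: dist_norm)
        also have "\<dots> \<le> L * dist y z"
          using \<open>L \<ge> 0\<close> by (intro mult_left_mono dist_bounded)
        finally show "norm (F \<sigma> (apply_bcontfun y \<sigma>) - F \<sigma> (apply_bcontfun z \<sigma>)) \<le> L * dist y z" .
      qed (use clip in auto)
      also have "\<dots> \<le> L * dist y z * (t - s)"
        using \<open>L \<ge> 0\<close> clip[of \<tau>] by (intro mult_left_mono) auto
      also have "\<dots> = L * (t - s) * dist y z" by simp
      also have "\<dots> \<le> 1 / 2 * dist y z"
        using small by (rule mult_right_mono) simp
      finally show "dist (apply_bcontfun (P y) \<tau>) (apply_bcontfun (P z) \<tau>) \<le> 1 / 2 * dist y z" .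
    qed
  qed
  then obtain Y where Y: "Y \<in> B" "P Y = Y" by blast
  define y where "y = apply_bcontfun Y"
  have le: "norm (y \<sigma>) \<le> r" for \<sigma>
    using Y by (auto simp: y_def B_def mem_PiC_iff Pi_def)
  have cont_y: "continuous_on {s..t} y"
    by (simp add: y_def)
  have y_eq: "y \<tau> = \<eta> + I y \<tau>" if "\<tau> \<in> {s..t}" for \<tau>
    using P_apply[OF Y(1), of \<tau>] that Y(2) by (simp add: y_def clip_def)
  have "solves_ivp F s \<eta> t y"
    unfolding solves_ivp_def
  proof (intro conjI ballI)
    show "y s = \<eta>"
      using y_eq[of s] \<open>s \<le> t\<close> by (simp add: I_def)
    fix \<tau> assume \<tau>: "\<tau> \<in> {s..t}"
    have "((\<lambda>\<tau>. \<eta> + I y \<tau>) has_vector_derivative F \<tau> (y \<tau>)) (at \<tau> within {s..t})"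
      unfolding I_def
      using integral_has_vector_derivative[OF contF[OF cont_y le] \<tau>]
      by (simp add: add.commute[of \<eta>] has_vector_derivative_add_const)
    then show "(y has_vector_derivative F \<tau> (y \<tau>)) (at \<tau> within {s..t})"
      by (rule has_vector_derivative_transform[OF \<tau> y_eq, rotated])
  qed
  moreover have "norm (y t - \<eta>) \<le> 2 * L * (t - s) * norm \<eta>"
  proof -
    \<comment> \<open>At a time where the norm of \<open>y\<close> is largest, the integral equation
      bounds this maximum by \<open>norm \<eta>\<close> plus half of itself. Hence
      \<open>norm y\<close> never exceeds \<open>2 * norm \<eta>\<close> on the interval, which is
      the source of the factor 2 in the claim.\<close>
    obtain \<tau> where \<tau>: "\<tau> \<in> {s..t}" and max: "\<And>\<sigma>. \<sigma> \<in> {s..t} \<Longrightarrow> norm (y \<sigma>) \<le> norm (y \<tau>)"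
      using continuous_attains_sup[OF compact_Icc _ continuous_on_norm[OF cont_y]] \<open>s \<le> t\<close>
      by (metis atLeastatMost_empty_iff2 not_less)
    have I_le: "norm (I y \<sigma>) \<le> L * (t - s) * norm (y \<tau>)" if "\<sigma> \<in> {s..t}" for \<sigma>
      using boundI[OF cont_y max le that] .
    have "norm (y \<tau>) \<le> norm \<eta> + norm (I y \<tau>)"
      using y_eq[OF \<tau>] norm_triangle_ineq[of \<eta> "I y \<tau>"] by simp
    also have "norm (I y \<tau>) \<le> 1 / 2 * norm (y \<tau>)"
      using I_le[OF \<tau>] mult_right_mono[OF small, of "norm (y \<tau>)"] by simp
    finally have "norm (y \<tau>) \<le> 2 * norm \<eta>" by simp
    then have "L * (t - s) * norm (y \<tau>) \<le> L * (t - s) * (2 * norm \<eta>)"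
      using \<open>L \<ge> 0\<close> \<open>s \<le> t\<close> by (intro mult_left_mono) auto
    with I_le[of t] show ?thesis
      using y_eq[of t] \<open>s \<le> t\<close> by simp
  qed
  ultimately show thesis by (rule that)
qed

text \<open>One constant serves every step inside \<open>{0..T}\<close>, because compactness of
  \<open>{0..T}\<close> and of the unit ball makes the local Lipschitz condition uniform there.
  Starting values of norm at most \<open>1 / 2\<close> match radius 1 in
  \<open>solves_ivp_exists\<close>.\<close>

lemma norm_sol_diff_le:
  fixes F :: "real \<Rightarrow> real ^ 'd \<Rightarrow> real ^ 'd"
  assumes cont: "\<And>y. continuous_on {0..} (\<lambda>t. F t y)"
    and lip: "local_lipschitz {0..} UNIV F"
    and zero: "\<And>t. t \<ge> 0 \<Longrightarrow> F t 0 = 0"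
  obtains L where "L > 0"
    "\<And>s t \<eta>. \<lbrakk>0 \<le> s; s \<le> t; t \<le> T; L * (t - s) \<le> 1 / 2; norm \<eta> \<le> 1 / 2\<rbrakk>
      \<Longrightarrow> norm (sol F t s \<eta> - \<eta>) \<le> 2 * L * (t - s) * norm \<eta>"
proof -
  have sub: "continuous_on {s..t} (\<lambda>\<tau>. F \<tau> x)" if "0 \<le> s" for s t x
    by (rule continuous_on_subset[OF cont]) (use that in auto)
  have lip_sub: "local_lipschitz {s..t} X F" if "0 \<le> s" for s t X
    by (rule local_lipschitz_subset[OF lip]) (use that in auto)
  obtain L' where L': "\<And>\<tau>. \<tau> \<in> {0..T} \<Longrightarrow> L'-lipschitz_on (cball 0 1) (F \<tau>)"
    by (rule local_lipschitz_compact_implies_lipschitz[where f = F,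
          OF lip_sub[of 0 T "cball 0 1"] compact_cball compact_Icc sub]) auto
  \<comment> \<open>The maximum makes the constant positive, so that it can later be divided
    by.\<close>
  define L where "L = max L' 1"
  show thesis
  proof (rule that[of L])
    show "L > 0" by (simp add: L_def)
    fix s t :: real and \<eta> :: "real ^ 'd"
    assume "0 \<le> s" "s \<le> t" "t \<le> T" and small: "L * (t - s) \<le> 1 / 2" and \<eta>: "norm \<eta> \<le> 1 / 2"
    \<comment> \<open>Joint continuity follows from continuity in time together with a local
      Lipschitz constant in space that is independent of time.\<close>
    have "continuous_on ({s..t} \<times> cball 0 1) (\<lambda>(\<tau>, x). F \<tau> x)"
      by (rule continuous_on_TimesI[OF lip_sub sub]) (use \<open>0 \<le> s\<close> in auto)
    moreover have "L-lipschitz_on (cball 0 1) (F \<tau>)" if "\<tau> \<in> {s..t}" for \<tau>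
      using L'[of \<tau>] that \<open>0 \<le> s\<close> \<open>t \<le> T\<close> by (auto simp: L_def intro: lipschitz_on_le)
    ultimately obtain y where y: "solves_ivp F s \<eta> t y"
      and "norm (y t - \<eta>) \<le> 2 * L * (t - s) * norm \<eta>"
      using solves_ivp_exists[of s t 1 F L \<eta>] zero \<open>0 \<le> s\<close> \<open>s \<le> t\<close> small \<eta> by auto
    moreover have "sol F t s \<eta> = y t"
      by (rule sol_eqI[OF sub lip_sub \<open>s \<le> t\<close> y]) (use \<open>0 \<le> s\<close> in auto)
    ultimately show "norm (sol F t s \<eta> - \<eta>) \<le> 2 * L * (t - s) * norm \<eta>" by simp
  qed
qed

section \<open>Bounds for the perturbed approximations\<close>

text \<open>Shifts the index by one, so that the recursion starts at 0 and is ready for induction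
  with \<open>Suc\<close>.\<close>

lemma approximationsE:
  assumes "y \<in> approximations F \<alpha> h"
  obtains v where "\<And>n. norm (v n) \<le> 1" "y 0 = 0"
    "\<And>n. y (real (Suc n) * h) =
      sol F (real (Suc n) * h) (real n * h) (y (real n * h)) + (h * \<alpha> h) *\<^sub>R v n"
    "\<And>n t. \<lbrakk>real n * h \<le> t; t < real (Suc n) * h\<rbrakk> \<Longrightarrow> y t = sol F t (real n * h) (y (real n * h))"
proof -
  from assms obtain v where v: "\<And>n. n \<ge> 1 \<Longrightarrow> norm (v n) \<le> 1" "y 0 = 0"
    "\<And>n. n \<ge> 1 \<Longrightarrow> y (real n * h) =
      sol F (real n * h) ((real n - 1) * h) (y ((real n - 1) * h)) + (h * \<alpha> h) *\<^sub>R v n"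
    "\<And>n t. \<lbrakk>n \<ge> 1; (real n - 1) * h \<le> t; t < real n * h\<rbrakk>
      \<Longrightarrow> y t = sol F t ((real n - 1) * h) (y ((real n - 1) * h))"
    unfolding approximations_def by blast
  show thesis
  proof (rule that[of "\<lambda>n. v (Suc n)"])
    show "norm (v (Suc n)) \<le> 1" "y 0 = 0" for n
      using v by simp_all
    show "y (real (Suc n) * h) =
      sol F (real (Suc n) * h) (real n * h) (y (real n * h)) + (h * \<alpha> h) *\<^sub>R v (Suc n)" for n
      using v(3)[of "Suc n"] by simp
    show "y t = sol F t (real n * h) (y (real n * h))"
      if "real n * h \<le> t" "t < real (Suc n) * h" for n t
      using v(4)[of "Suc n" t] that by simp
  qed
qed

text \<open>Makes the supremum in \<open>err\<close> nonnegative; over an empty family it would be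
  minus infinity.\<close>

lemma zero_in_approximations:
  fixes F :: "real \<Rightarrow> real ^ 'd \<Rightarrow> real ^ 'd"
  assumes cont: "\<And>y. continuous_on {0..} (\<lambda>t. F t y)"
    and lip: "local_lipschitz {0..} UNIV F"
    and zero: "\<And>t. t \<ge> 0 \<Longrightarrow> F t 0 = 0" and "h > 0"
  shows "(\<lambda>_. 0) \<in> approximations F \<alpha> h"
proof -
  have "sol F t s 0 = 0" if "0 \<le> s" "s \<le> t" for s t
  proof (rule sol_eqI[where y = "\<lambda>_. 0"])
    show "continuous_on {s..t} (\<lambda>\<tau>. F \<tau> x)" for x
      by (rule continuous_on_subset[OF cont]) (use that in auto)
    show "local_lipschitz {s..t} UNIV F"
      by (rule local_lipschitz_subset[OF lip]) (use that in auto)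
    show "solves_ivp F s 0 t (\<lambda>_. 0)"
      using zero that by (simp add: solves_ivp_def)
  qed (use that in simp)
  moreover have "0 \<le> (real n - 1) * h" "(real n - 1) * h \<le> real n * h" if "n \<ge> 1" for n
    using that \<open>h > 0\<close> by simp_all
  ultimately show ?thesis
    unfolding approximations_def by (auto intro!: exI[of _ "\<lambda>_. 0"])
qed

text \<open>Discrete Gronwall: one step multiplies the norm by at most \<open>1 + 2 * L * h\<close>
  and adds a jump of at most \<open>h * \<alpha> h\<close>, so the grid values stay below
  \<open>C * \<alpha> h\<close>. Between grid points the flow adds at most \<open>2 * L * h\<close>
  times this, and \<open>2 * L * h \<le> 1\<close> gives the factor 2. Given this bound, each full
  step changes the value by at most \<open>h * \<alpha> h\<close> times
  \<open>2 * L * C + 1\<close>, which gives the modulus of continuity.\<close>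

lemma
  fixes F :: "real \<Rightarrow> real ^ 'd \<Rightarrow> real ^ 'd"
  assumes step: "\<And>s t \<eta>. \<lbrakk>0 \<le> s; s \<le> t; t \<le> T; L * (t - s) \<le> 1 / 2; norm \<eta> \<le> 1 / 2\<rbrakk>
      \<Longrightarrow> norm (sol F t s \<eta> - \<eta>) \<le> 2 * L * (t - s) * norm \<eta>"
    and "L > 0" "h > 0" "\<alpha> h \<ge> 0" and Lh: "L * h \<le> 1 / 2"
    and C: "C = T * exp (2 * L * T)" and C_small: "C * \<alpha> h \<le> 1 / 2"
    and y: "y \<in> approximations F \<alpha> h"
  shows norm_approximation_le: "t \<in> {0..T} \<Longrightarrow> norm (y t) \<le> 2 * C * \<alpha> h"
    and norm_approximation_diff_le:
      "\<lbrakk>a \<in> {0..T}; b \<in> {0..T}\<rbrakk> \<Longrightarrow> norm (y b - y a) \<le> (2 * L * C + 1) * (\<bar>b - a\<bar> + 3 * h) * \<alpha> h"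
proof -
  define z where "z n = y (real n * h)" for n
  define D where "D = 2 * L * C + 1"
  obtain v where v: "\<And>n. norm (v n) \<le> 1" and y0: "y 0 = 0"
    and z_Suc: "\<And>n. z (Suc n) =
      sol F (real (Suc n) * h) (real n * h) (z n) + (h * \<alpha> h) *\<^sub>R v n"
    and y_eq: "\<And>n t. \<lbrakk>real n * h \<le> t; t < real (Suc n) * h\<rbrakk> \<Longrightarrow> y t = sol F t (real n * h) (z n)"
    using approximationsE[OF y] unfolding z_def by blast
  have h\<alpha>v: "norm ((h * \<alpha> h) *\<^sub>R v n) \<le> h * \<alpha> h" for n
    using mult_left_mono[OF v[of n], of "h * \<alpha> h"] \<open>h > 0\<close> \<open>\<alpha> h \<ge> 0\<close> by simp
  have le_C: "real n * h * \<alpha> h * exp (2 * L * (real n * h)) \<le> C * \<alpha> h" if "real n * h \<le> T" for n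
  proof -
    have "(real n * h) * exp (2 * L * (real n * h)) \<le> T * exp (2 * L * T)"
      using that \<open>L > 0\<close> \<open>h > 0\<close> by (intro mult_mono) (auto intro: order_trans[rotated])
    from mult_right_mono[OF this \<open>\<alpha> h \<ge> 0\<close>] show ?thesis
      by (simp add: C mult_ac)
  qed
  have flow: "norm (sol F t (real n * h) (z n) - z n) \<le> 2 * L * h * norm (z n)"
    if "real n * h \<le> t" "t \<le> real (Suc n) * h" "t \<le> T" "norm (z n) \<le> 1 / 2" for n t
  proof -
    have "L * (t - real n * h) \<le> L * h"
      using that \<open>L > 0\<close> by (intro mult_left_mono) (auto simp: algebra_simps)
    then have "norm (sol F t (real n * h) (z n) - z n) \<le> 2 * L * (t - real n * h) * norm (z n)"
      using Lh that \<open>h > 0\<close> by (intro step) auto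
    also have "\<dots> \<le> 2 * L * h * norm (z n)"
      using that \<open>L > 0\<close> by (intro mult_right_mono mult_left_mono) (auto simp: algebra_simps)
    finally show ?thesis .
  qed
  \<comment> \<open>The bound keeps its dependence on \<open>n\<close> so that the induction closes.
    It also guarantees, through \<open>C * \<alpha> h \<le> 1 / 2\<close>, that each grid value
    stays where the one-step estimate is valid.\<close>
  have z_le': "norm (z n) \<le> real n * h * \<alpha> h * exp (2 * L * (real n * h))" if "real n * h \<le> T" for n
    using that
  proof (induction n)
    case 0
    then show ?case by (simp add: z_def y0)
  next
    case (Suc n)
    have nT: "real n * h \<le> T"
      using Suc.prems \<open>h > 0\<close> by (simp add: algebra_simps)
    let ?b = "real n * h * \<alpha> h * exp (2 * L * (real n * h))"
    have IH: "norm (z n) \<le> ?b" by (rule Suc.IH[OF nT])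
    let ?s = "sol F (real (Suc n) * h) (real n * h) (z n)"
    have "norm (z n) \<le> 1 / 2"
      using IH le_C[OF nT] C_small by linarith
    then have f: "norm (?s - z n) \<le> 2 * L * h * norm (z n)"
      using Suc.prems \<open>h > 0\<close> by (intro flow) (auto simp: algebra_simps)
    have "norm (z (Suc n)) \<le> norm ?s + h * \<alpha> h"
      unfolding z_Suc using h\<alpha>v[of n] norm_triangle_ineq[of ?s "(h * \<alpha> h) *\<^sub>R v n"] by linarith
    also have "norm ?s \<le> norm (z n) + 2 * L * h * norm (z n)"
      using f norm_triangle_sub[of ?s "z n"] by linarith
    also have "\<dots> = (1 + 2 * L * h) * norm (z n)"
      by (simp add: algebra_simps)
    also have "\<dots> \<le> exp (2 * L * h) * ?b"
      using IH \<open>L > 0\<close> \<open>h > 0\<close> by (intro mult_mono exp_ge_add_one_self) auto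
    \<comment> \<open>The new jump is enlarged by the exponential of the new time, so that both
      summands carry the same exponential factor.\<close>
    also have "\<dots> + h * \<alpha> h \<le> exp (2 * L * h) * ?b + h * \<alpha> h * exp (2 * L * (real (Suc n) * h))"
      using \<open>L > 0\<close> \<open>h > 0\<close> \<open>\<alpha> h \<ge> 0\<close> mult_left_mono[of 1 "exp (2 * L * (real (Suc n) * h))" "h * \<alpha> h"] by simp
    also have "\<dots> = real (Suc n) * h * \<alpha> h * exp (2 * L * (real (Suc n) * h))"
      by (simp add: algebra_simps exp_add)
    finally show ?case by simp
  qed
  have z_le: "norm (z n) \<le> C * \<alpha> h" if "real n * h \<le> T" for n
    using z_le'[OF that] le_C[OF that] by linarith
  have flow': "norm (sol F t (real n * h) (z n) - z n) \<le> 2 * L * h * (C * \<alpha> h)"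
    if "real n * h \<le> t" "t \<le> real (Suc n) * h" "t \<le> T" for n t
  proof -
    have "real n * h \<le> T" using that by linarith
    from z_le[OF this] C_small
    have "norm (sol F t (real n * h) (z n) - z n) \<le> 2 * L * h * norm (z n)"
      by (intro flow that) linarith
    also have "\<dots> \<le> 2 * L * h * (C * \<alpha> h)"
      using z_le[OF \<open>real n * h \<le> T\<close>] \<open>L > 0\<close> \<open>h > 0\<close> by (intro mult_left_mono) auto
    finally show ?thesis .
  qed
  have z_diff_Suc: "norm (z (Suc n) - z n) \<le> h * D * \<alpha> h" if "real (Suc n) * h \<le> T" for n
  proof -
    have "z (Suc n) - z n =
        (sol F (real (Suc n) * h) (real n * h) (z n) - z n) + (h * \<alpha> h) *\<^sub>R v n"
      by (simp add: z_Suc)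
    then have "norm (z (Suc n) - z n) \<le>
        norm (sol F (real (Suc n) * h) (real n * h) (z n) - z n) + h * \<alpha> h"
      using h\<alpha>v[of n] by (metis add_left_mono norm_triangle_le)
    also have "\<dots> \<le> 2 * L * h * (C * \<alpha> h) + h * \<alpha> h"
      using that \<open>h > 0\<close> by (intro add_right_mono flow') (auto simp: algebra_simps)
    finally show ?thesis by (simp add: D_def algebra_simps)
  qed
  have z_diff: "norm (z (m + k) - z m) \<le> real k * h * D * \<alpha> h" if "real (m + k) * h \<le> T" for m k
    using that
  proof (induction k)
    case 0
    then show ?case by simp
  next
    case (Suc k)
    have "norm (z (m + k) - z m) \<le> real k * h * D * \<alpha> h"
      using Suc.prems \<open>h > 0\<close> by (intro Suc.IH) (simp add: algebra_simps)
    moreover have "norm (z (Suc (m + k)) - z (m + k)) \<le> h * D * \<alpha> h"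
      using Suc.prems by (intro z_diff_Suc) simp
    moreover have "norm (z (m + Suc k) - z m) \<le>
        norm (z (Suc (m + k)) - z (m + k)) + norm (z (m + k) - z m)"
      using norm_triangle_ineq[of "z (Suc (m + k)) - z (m + k)" "z (m + k) - z m"] by simp
    ultimately show ?case by (simp add: algebra_simps)
  qed
  \<comment> \<open>Index of the last grid point not after \<open>t\<close>. The pieces are
    half-open, so \<open>y t\<close> is the flow started from \<open>z (N t)\<close> even when
    \<open>t\<close> is itself a grid point.\<close>
  define N where "N t = nat \<lfloor>t / h\<rfloor>" for t
  have N: "real (N t) * h \<le> t" "t < real (Suc (N t)) * h" if "t \<in> {0..T}" for t
  proof -
    have "real (N t) = of_int \<lfloor>t / h\<rfloor>"
      using that \<open>h > 0\<close> by (simp add: N_def)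
    then have "real (N t) \<le> t / h" "t / h < real (N t) + 1"
      by linarith+
    then show "real (N t) * h \<le> t" "t < real (Suc (N t)) * h"
      using \<open>h > 0\<close> by (simp_all add: field_simps)
  qed
  have y_z: "norm (y t - z (N t)) \<le> 2 * L * h * (C * \<alpha> h)" if "t \<in> {0..T}" for t
    using flow'[of "N t" t] N[OF that] y_eq[of "N t" t] that by simp
  show "norm (y t) \<le> 2 * C * \<alpha> h" if t: "t \<in> {0..T}" for t
  proof -
    have "real (N t) * h \<le> T" using N[OF t] t by simp
    note z_le[OF this]
    moreover from order_trans[OF norm_ge_zero this] have "2 * L * h * (C * \<alpha> h) \<le> 1 * (C * \<alpha> h)"
      using Lh by (intro mult_right_mono) auto
    ultimately show ?thesis
      using y_z[OF t] norm_triangle_sub[of "y t" "z (N t)"] by simp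
  qed
  have "D \<ge> 1" if "T \<ge> 0"
    using that \<open>L > 0\<close> by (simp add: D_def C)
  \<comment> \<open>The full steps from \<open>N a\<close> to \<open>N b\<close> take total time
    less than \<open>b - a + h\<close>; moving from each of \<open>a\<close> and \<open>b\<close> to
    its grid point costs one further \<open>h\<close>. This is the origin of
    \<open>3 * h\<close>.\<close>
  have ordered: "norm (y b - y a) \<le> D * (b - a + 3 * h) * \<alpha> h"
    if ab: "a \<in> {0..T}" "b \<in> {0..T}" "a \<le> b" for a b
  proof -
    have "N a \<le> N b"
      unfolding N_def using ab \<open>h > 0\<close> by (intro nat_mono floor_mono divide_right_mono) auto
    then obtain k where k: "N b = N a + k" by (metis le_add_diff_inverse)
    have D: "D \<ge> 1" using \<open>T \<ge> 0 \<Longrightarrow> D \<ge> 1\<close> ab by simp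
    have "norm (z (N b) - z (N a)) \<le> real k * h * D * \<alpha> h"
      unfolding k using N(1)[OF ab(2)] ab(2) k by (intro z_diff) simp
    also have "\<dots> \<le> (b - a + h) * D * \<alpha> h"
      using N(1)[OF ab(2)] N(2)[OF ab(1)] D \<open>\<alpha> h \<ge> 0\<close>
      by (intro mult_right_mono) (auto simp: k algebra_simps)
    finally have 1: "norm (z (N b) - z (N a)) \<le> (b - a + h) * D * \<alpha> h" .
    have 2: "2 * L * h * (C * \<alpha> h) \<le> h * D * \<alpha> h"
      using \<open>h > 0\<close> \<open>\<alpha> h \<ge> 0\<close> by (simp add: D_def algebra_simps)
    have "norm (y b - y a) \<le> norm (y b - z (N b)) + norm (z (N b) - z (N a)) + norm (y a - z (N a))"
      by norm
    also have "\<dots> \<le> h * D * \<alpha> h + (b - a + h) * D * \<alpha> h + h * D * \<alpha> h"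
      using y_z[OF ab(1)] y_z[OF ab(2)] 1 2 by linarith
    finally show ?thesis by (simp add: algebra_simps)
  qed
  show "norm (y b - y a) \<le> (2 * L * C + 1) * (\<bar>b - a\<bar> + 3 * h) * \<alpha> h"
    if "a \<in> {0..T}" "b \<in> {0..T}"
    using ordered[of a b] ordered[of b a] that
    by (cases "a \<le> b") (auto simp: D_def norm_minus_commute)
qed

section \<open>Uniform approach to an upper limit\<close>

text \<open>A finite net reduces the claim to finitely many upper limits, which are handled
  simultaneously. Three errors of \<open>\<epsilon> / 3\<close> arise: from \<open>r t h\<close> to
  \<open>r x h\<close> at a net point \<open>x\<close>, from there to the upper limit at
  \<open>x\<close>, and from that to the upper limit at \<open>t\<close>.\<close>

lemma eventually_le_Limsup_uniformly:
  fixes r :: "'a :: metric_space \<Rightarrow> 'b \<Rightarrow> ereal"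
  assumes "compact S" and "G \<noteq> bot"
    and equi: "\<And>e. e > 0 \<Longrightarrow>
      \<exists>d>0. \<forall>\<^sub>F h in G. \<forall>a\<in>S. \<forall>b\<in>S. dist a b < d \<longrightarrow> r b h \<le> r a h + ereal e"
    and bound: "\<And>t. t \<in> S \<Longrightarrow> \<forall>\<^sub>F h in G. 0 \<le> r t h \<and> r t h \<le> ereal M"
    and "\<epsilon> > 0"
  shows "\<forall>\<^sub>F h in G. \<forall>t\<in>S. r t h \<le> Limsup G (r t) + ereal \<epsilon>"
proof -
  define E where "E t = Limsup G (r t)" for t
  from equi[of "\<epsilon> / 3"] \<open>\<epsilon> > 0\<close> obtain d where "d > 0"
    and d: "\<forall>\<^sub>F h in G. \<forall>a\<in>S. \<forall>b\<in>S. dist a b < d \<longrightarrow> r b h \<le> r a h + ereal (\<epsilon> / 3)"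
    by auto
  obtain K where K: "finite K" "K \<subseteq> S" "S \<subseteq> (\<Union>x\<in>K. ball x d)"
    by (rule compactE_image[OF \<open>compact S\<close>, of S "\<lambda>x. ball x d"]) (use \<open>d > 0\<close> in auto)
  have E_fin: "\<bar>E x\<bar> \<noteq> \<infinity>" if "x \<in> S" for x
  proof -
    have "0 \<le> E x"
      unfolding E_def by (rule le_Limsup[OF \<open>G \<noteq> bot\<close>]) (use bound[OF that] in \<open>auto elim: eventually_mono\<close>)
    moreover have "E x \<le> ereal M"
      unfolding E_def by (rule Limsup_bounded) (use bound[OF that] in \<open>auto elim: eventually_mono\<close>)
    ultimately show ?thesis by (cases "E x") auto
  qed
  \<comment> \<open>The upper limit inherits the modulus of continuity, since it is monotone and
    commutes with adding a real constant.\<close>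
  have E_le: "E x \<le> E t + ereal (\<epsilon> / 3)" if "x \<in> S" "t \<in> S" "dist x t < d" for x t
  proof -
    have "E x \<le> Limsup G (\<lambda>h. r t h + ereal (\<epsilon> / 3))"
      unfolding E_def using d that
      by (intro Limsup_mono) (auto elim!: eventually_mono simp: dist_commute)
    also have "\<dots> = E t + ereal (\<epsilon> / 3)"
      unfolding E_def by (rule Limsup_add_ereal_right[OF \<open>G \<noteq> bot\<close>]) simp
    finally show ?thesis .
  qed
  \<comment> \<open>Finiteness of \<open>E x\<close>, which comes from the bound \<open>M\<close>,
    makes adding \<open>\<epsilon> / 3\<close> a strict increase in the extended reals.\<close>
  have "\<forall>\<^sub>F h in G. r x h < E x + ereal (\<epsilon> / 3)" if "x \<in> K" for x
  proof (rule Limsup_lessD)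
    show "Limsup G (r x) < E x + ereal (\<epsilon> / 3)"
      using E_fin[of x] that K(2) \<open>\<epsilon> > 0\<close> by (cases "E x") (auto simp: E_def)
  qed
  then have "\<forall>\<^sub>F h in G. \<forall>x\<in>K. r x h < E x + ereal (\<epsilon> / 3)"
    by (intro eventually_ball_finite K(1)) blast
  with d show ?thesis
  proof eventually_elim
    case (elim h)
    show ?case
    proof
      fix t assume "t \<in> S"
      then obtain x where x: "x \<in> K" "dist x t < d" using K(3) by auto
      with K(2) have "x \<in> S" by blast
      have "r t h \<le> r x h + ereal (\<epsilon> / 3)"
        using elim(1) \<open>x \<in> S\<close> \<open>t \<in> S\<close> x by blast
      also have "\<dots> \<le> E x + ereal (\<epsilon> / 3) + ereal (\<epsilon> / 3)"
        using elim(2) x by (intro add_right_mono) (auto intro: less_imp_le)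
      also have "\<dots> \<le> E t + ereal (\<epsilon> / 3) + ereal (\<epsilon> / 3) + ereal (\<epsilon> / 3)"
        using E_le[OF \<open>x \<in> S\<close> \<open>t \<in> S\<close> x(2)] by (intro add_right_mono)
      also have "\<dots> = E t + ereal \<epsilon>"
        using E_fin[OF \<open>t \<in> S\<close>] by (cases "E t") auto
      finally show "r t h \<le> Limsup G (r t) + ereal \<epsilon>" by (simp add: E_def)
    qed
  qed
qed

section \<open>The quotient of \<open>err\<close> by \<open>\<alpha> h\<close> as \<open>h\<close>
  tends to 0\<close>

theorem theorem4p5:
  fixes F :: "real \<Rightarrow> real ^ 'd \<Rightarrow> real ^ 'd" and \<alpha> :: "real \<Rightarrow> real"
  assumes F_cont: "\<And>y. continuous_on {0..} (\<lambda>t. F t y)"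
    and F_lipschitz: "local_lipschitz {0..} UNIV F"
    and F_zero: "\<And>t. t \<ge> 0 \<Longrightarrow> F t 0 = 0"
    and \<alpha>_range: "\<alpha> ` {0..} \<subseteq> {0..}"
    and \<alpha>_cont: "continuous_on {0..} \<alpha>"
    and \<alpha>_strict_mono: "strict_mono_on {0..} \<alpha>"
    and \<alpha>_zero: "\<alpha> 0 = 0"
  shows "(\<forall>T>0. \<forall>\<epsilon>>0. \<exists>h\<^sub>0>0. \<forall>h. 0 < h \<and> h < h\<^sub>0 \<longrightarrow>
            (\<forall>t\<in>{0..T}. err F \<alpha> t h \<le> (err_limsup F \<alpha> t + ereal \<epsilon>) * ereal (\<alpha> h)))
       \<and> (\<forall>t\<ge>0. \<forall>\<theta>. ereal \<theta> < err_limsup F \<alpha> t \<longrightarrow>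
            (\<exists>\<epsilon>>0. \<forall>\<delta>>0. \<exists>h. 0 < h \<and> h < \<delta> \<and> err F \<alpha> t h > ereal ((\<theta> + \<epsilon>) * \<alpha> h)))"
proof -
  have \<alpha>_pos: "\<alpha> h > 0" if "h > 0" for h
    using strict_mono_onD[OF \<alpha>_strict_mono, of 0 h] that \<alpha>_zero by simp
  have \<alpha>_lim: "(\<alpha> \<longlongrightarrow> 0) (at_right 0)"
  proof -
    have "(\<alpha> \<longlongrightarrow> \<alpha> 0) (at 0 within {0..})"
      using \<alpha>_cont by (simp add: continuous_on_def)
    then have "(\<alpha> \<longlongrightarrow> \<alpha> 0) (at 0 within {0<..})"
      by (rule tendsto_within_subset) auto
    then show ?thesis by (simp add: \<alpha>_zero)
  qed
  have "\<exists>h\<^sub>0>0. \<forall>h. 0 < h \<and> h < h\<^sub>0 \<longrightarrow>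
      (\<forall>t\<in>{0..T}. err F \<alpha> t h \<le> (err_limsup F \<alpha> t + ereal \<epsilon>) * ereal (\<alpha> h))"
    if "T > 0" "\<epsilon> > 0" for T \<epsilon>
  proof -
    obtain L where "L > 0" and step:
      "\<And>s t \<eta>. \<lbrakk>0 \<le> s; s \<le> t; t \<le> T; L * (t - s) \<le> 1 / 2; norm \<eta> \<le> 1 / 2\<rbrakk>
        \<Longrightarrow> norm (sol F t s \<eta> - \<eta>) \<le> 2 * L * (t - s) * norm \<eta>"
      using norm_sol_diff_le[OF F_cont F_lipschitz F_zero, of T] by blast
    define C where "C = T * exp (2 * L * T)"
    define D where "D = 2 * L * C + 1"
    have "C > 0" using \<open>T > 0\<close> by (simp add: C_def)
    then have "D > 0" using \<open>L > 0\<close> by (simp add: D_def add_pos_pos)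
    have "\<forall>\<^sub>F h in at_right 0. \<alpha> h < 1 / (2 * C)"
      using \<open>C > 0\<close> by (intro order_tendstoD(2)[OF \<alpha>_lim]) simp
    moreover have "\<forall>\<^sub>F h in at_right 0. h < 1 / (2 * L)"
      using \<open>L > 0\<close> by (intro order_tendstoD(2)[OF tendsto_ident_at]) simp
    \<comment> \<open>These are the smallness conditions under which the two bounds on
      approximations hold.\<close>
    ultimately have small:
      "\<forall>\<^sub>F h in at_right 0. h > 0 \<and> L * h \<le> 1 / 2 \<and> C * \<alpha> h \<le> 1 / 2"
      using eventually_at_right_less[of "0 :: real"]
      by eventually_elim (use \<open>C > 0\<close> \<open>L > 0\<close> in \<open>auto simp: field_simps\<close>)
    have "\<forall>\<^sub>F h in at_right 0. \<forall>t\<in>{0..T}.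
        err F \<alpha> t h / ereal (\<alpha> h) \<le> Limsup (at_right 0) (\<lambda>h. err F \<alpha> t h / ereal (\<alpha> h)) + ereal \<epsilon>"
    proof (rule eventually_le_Limsup_uniformly[where M = "2 * C"])
      show "\<forall>\<^sub>F h in at_right 0. 0 \<le> err F \<alpha> t h / ereal (\<alpha> h) \<and> err F \<alpha> t h / ereal (\<alpha> h) \<le> ereal (2 * C)"
        if "t \<in> {0..T}" for t
        using small
      proof eventually_elim
        case (elim h)
        then have "h > 0" "\<alpha> h > 0" using \<alpha>_pos by auto
        have "err F \<alpha> t h \<le> ereal (2 * C * \<alpha> h)"
          unfolding err_def
        proof (rule SUP_least)
          fix y assume "y \<in> approximations F \<alpha> h"
          then show "ereal (norm (y t)) \<le> ereal (2 * C * \<alpha> h)"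
            using norm_approximation_le[OF step \<open>L > 0\<close> \<open>h > 0\<close> _ _ C_def _ _ that] elim \<open>\<alpha> h > 0\<close>
            by auto
        qed
        moreover have "0 \<le> err F \<alpha> t h"
          unfolding err_def
          using SUP_upper[OF zero_in_approximations[OF F_cont F_lipschitz F_zero \<open>h > 0\<close>, of \<alpha>],
              of "\<lambda>y. ereal (norm (y t))"]
          by (simp add: zero_ereal_def)
        ultimately show ?case
          using \<open>\<alpha> h > 0\<close> by (cases "err F \<alpha> t h") (auto simp: field_simps)
      qed
      show "\<exists>d>0. \<forall>\<^sub>F h in at_right 0. \<forall>a\<in>{0..T}. \<forall>b\<in>{0..T}. dist a b < d \<longrightarrow>
          err F \<alpha> b h / ereal (\<alpha> h) \<le> err F \<alpha> a h / ereal (\<alpha> h) + ereal e" if "e > 0" for e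
      proof (intro exI conjI)
        \<comment> \<open>Together with \<open>h < e / (6 * D)\<close> this splits the allowance
          \<open>e\<close> evenly: \<open>D * \<bar>b - a\<bar>\<close> and
          \<open>D * (3 * h)\<close> are each at most \<open>e / 2\<close>.\<close>
        show "e / (2 * D) > 0" using that \<open>D > 0\<close> by simp
        then have "\<forall>\<^sub>F h in at_right 0. h < e / (6 * D)"
          using that \<open>D > 0\<close> by (intro order_tendstoD(2)[OF tendsto_ident_at]) simp
        with small show "\<forall>\<^sub>F h in at_right 0. \<forall>a\<in>{0..T}. \<forall>b\<in>{0..T}. dist a b < e / (2 * D) \<longrightarrow>
          err F \<alpha> b h / ereal (\<alpha> h) \<le> err F \<alpha> a h / ereal (\<alpha> h) + ereal e"
        proof eventually_elim
          case (elim h)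
          then have "h > 0" "\<alpha> h > 0" using \<alpha>_pos by auto
          show ?case
          proof (intro ballI impI)
            fix a b assume ab: "a \<in> {0..T}" "b \<in> {0..T}" and "dist a b < e / (2 * D)"
            then have "D * (\<bar>b - a\<bar> + 3 * h) \<le> e"
              using elim(2) \<open>D > 0\<close> by (simp add: dist_real_def abs_minus_commute field_simps)
            then have le: "D * (\<bar>b - a\<bar> + 3 * h) * \<alpha> h \<le> e * \<alpha> h"
              using \<open>\<alpha> h > 0\<close> by (intro mult_right_mono) auto
            have "err F \<alpha> b h \<le> err F \<alpha> a h + ereal (e * \<alpha> h)"
              unfolding err_def[of F \<alpha> b]
            proof (rule SUP_least)
              fix y assume y: "y \<in> approximations F \<alpha> h"
              have "norm (y b - y a) \<le> D * (\<bar>b - a\<bar> + 3 * h) * \<alpha> h"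
                using norm_approximation_diff_le[OF step \<open>L > 0\<close> \<open>h > 0\<close> _ _ C_def _ y ab] elim \<open>\<alpha> h > 0\<close>
                by (auto simp: D_def)
              with le have "norm (y b) \<le> norm (y a) + e * \<alpha> h"
                using norm_triangle_sub[of "y b" "y a"] by linarith
              then have "ereal (norm (y b)) \<le> ereal (norm (y a)) + ereal (e * \<alpha> h)" by simp
              also have "\<dots> \<le> err F \<alpha> a h + ereal (e * \<alpha> h)"
                unfolding err_def by (intro add_right_mono SUP_upper y)
              finally show "ereal (norm (y b)) \<le> err F \<alpha> a h + ereal (e * \<alpha> h)" .
            qed
            then show "err F \<alpha> b h / ereal (\<alpha> h) \<le> err F \<alpha> a h / ereal (\<alpha> h) + ereal e"
              using \<open>\<alpha> h > 0\<close>
              by (cases "err F \<alpha> b h"; cases "err F \<alpha> a h") (auto simp: field_simps)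
          qed
        qed
      qed
    qed (use \<open>\<epsilon> > 0\<close> in auto)
    then obtain h\<^sub>0 where "h\<^sub>0 > 0" and h\<^sub>0: "\<And>h t. \<lbrakk>0 < h; h < h\<^sub>0; t \<in> {0..T}\<rbrakk> \<Longrightarrow>
        err F \<alpha> t h / ereal (\<alpha> h) \<le> err_limsup F \<alpha> t + ereal \<epsilon>"
      unfolding err_limsup_def eventually_at_right_field by blast
    show ?thesis
    proof (intro exI conjI allI impI ballI)
      fix h t assume "0 < h \<and> h < h\<^sub>0" "t \<in> {0..T}"
      then show "err F \<alpha> t h \<le> (err_limsup F \<alpha> t + ereal \<epsilon>) * ereal (\<alpha> h)"
        using h\<^sub>0[of h t] \<alpha>_pos[of h] by (simp add: ereal_divide_le_pos mult.commute)
    qed (rule \<open>h\<^sub>0 > 0\<close>)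
  qed
  moreover have "\<exists>\<epsilon>>0. \<forall>\<delta>>0. \<exists>h. 0 < h \<and> h < \<delta> \<and> err F \<alpha> t h > ereal ((\<theta> + \<epsilon>) * \<alpha> h)"
    if "ereal \<theta> < err_limsup F \<alpha> t" for t \<theta>
  proof -
    \<comment> \<open>A real \<open>\<theta>'\<close> strictly between fixes the gap
      \<open>\<theta>' - \<theta>\<close> before \<open>\<delta>\<close> is given. If the claim
      failed for some \<open>\<delta>\<close>, the quotient would be at most
      \<open>\<theta>'\<close> for all smaller \<open>h\<close>, and so would its upper
      limit.\<close>
    from that obtain \<theta>' where "\<theta> < \<theta>'" and \<theta>': "ereal \<theta>' < err_limsup F \<alpha> t"
      using ereal_dense2 by (metis less_ereal.simps(1))
    show ?thesis
    proof (rule exI[of _ "\<theta>' - \<theta>"], intro conjI allI impI)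
      show "\<theta>' - \<theta> > 0" using \<open>\<theta> < \<theta>'\<close> by simp
      fix \<delta> :: real assume "\<delta> > 0"
      show "\<exists>h. 0 < h \<and> h < \<delta> \<and> err F \<alpha> t h > ereal ((\<theta> + (\<theta>' - \<theta>)) * \<alpha> h)"
      proof (rule ccontr)
        assume no: "\<nexists>h. 0 < h \<and> h < \<delta> \<and> err F \<alpha> t h > ereal ((\<theta> + (\<theta>' - \<theta>)) * \<alpha> h)"
        have "err F \<alpha> t h / ereal (\<alpha> h) \<le> ereal \<theta>'" if "0 < h" "h < \<delta>" for h
        proof -
          have "err F \<alpha> t h \<le> ereal (\<theta>' * \<alpha> h)"
            using no that by (simp add: not_less) (meson not_less)
          then show ?thesis
            using \<alpha>_pos[of h] that by (simp add: ereal_divide_le_pos mult.commute)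
        qed
        then have "err_limsup F \<alpha> t \<le> ereal \<theta>'"
          unfolding err_limsup_def using \<open>\<delta> > 0\<close>
          by (intro Limsup_bounded) (auto simp: eventually_at_right_field)
        with \<theta>' show False by simp
      qed
    qed
  qed
  ultimately show ?thesis by blast
qed

end
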